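(* Let $H$ be a separable Hilbert space and let $A,B$ be linear operators on $H$ with finite Hilbert-Schmidt norms. Then $$\|[A,B]\|^2\le 2\,\|A\|^2\cdot\|B\|^2 .$$
   Context: Here $\|\cdot\|$ denotes the Hilbert-Schmidt norm and $[A,B]=AB-BA$. *)

theory Defs
  imports "HOL-Analysis.Analysis"
begin

(* The scalars of a Hilbert space: a normed field extension of the reals with an isometric
   embedding into the complex numbers, i.e. the real or the complex field (see
   range_to_complex below). It is used to treat both kinds of Hilbert space at once. *)
class real_or_complex = real_normed_field +
  fixes to_complex :: "'a \<Rightarrow> complex"
  assumes to_complex_add: "to_complex (a + b) = to_complex a + to_complex b"
    and to_complex_mult: "to_complex (a * b) = to_complex a * to_complex b"
    and to_complex_scaleR: "to_complex (scaleR r a) = scaleR r (to_complex a)"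
    and norm_to_complex: "norm (to_complex a) = norm a"

instantiation real :: real_or_complex
begin
definition "to_complex = complex_of_real"
instance by standard (simp_all add: to_complex_real_def scaleR_conv_of_real)
end

instantiation complex :: real_or_complex
begin
definition "to_complex = (\<lambda>z::complex. z)"
instance by standard (simp_all add: to_complex_complex_def)
end

lemma to_complex_of_real: "to_complex (of_real r :: 'k::real_or_complex) = of_real r"
proof -
  have "to_complex (1::'k) * to_complex (1::'k) = to_complex (1::'k)"
    by (simp flip: to_complex_mult)
  moreover have "to_complex (1::'k) \<noteq> 0"
    by (metis norm_to_complex norm_one norm_zero zero_neq_one)
  ultimately have "to_complex (1::'k) = 1" by simp
  then show ?thesis by (simp add: of_real_def to_complex_scaleR)
qed

lemma range_to_complex:
  "range (to_complex :: 'k::real_or_complex \<Rightarrow> complex) = \<real> \<or>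
   range (to_complex :: 'k \<Rightarrow> complex) = UNIV"
proof (cases "range (to_complex :: 'k \<Rightarrow> complex) \<subseteq> \<real>")
  case True
  have "complex_of_real r \<in> range (to_complex :: 'k \<Rightarrow> complex)" for r
    by (metis rangeI to_complex_of_real)
  with True show ?thesis by (auto simp: Reals_def)
next
  case False
  then obtain k :: 'k where k: "to_complex k \<notin> \<real>" by auto
  then have im: "Im (to_complex k) \<noteq> 0" by (simp add: complex_is_Real_iff)
  have "z \<in> range (to_complex :: 'k \<Rightarrow> complex)" for z
  proof -
    define t where "t = Im z / Im (to_complex k)"
    define s where "s = Re z - t * Re (to_complex k)"
    have "to_complex (of_real s + of_real t * k) = of_real s + of_real t * to_complex k"
      by (simp only: to_complex_add to_complex_mult to_complex_of_real)
    also have "\<dots> = z"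
      using im by (simp add: complex_eq_iff s_def t_def del: of_real_diff of_real_divide of_real_mult)
    finally have "to_complex (of_real s + of_real t * k) = z" .
    then show ?thesis by (metis rangeI)
  qed
  then show ?thesis by blast
qed

(* Completeness comes from the class banach; the axioms ip_self and scale_of_real say that
   the norm and the real vector space structure of that class are the ones given by the inner
   product ip (linear in its first argument) and by the scalar multiplication. *)
locale hilbert_space = vector_space smul
  for smul :: "'k::real_or_complex \<Rightarrow> 'a::banach \<Rightarrow> 'a" +
  fixes ip :: "'a \<Rightarrow> 'a \<Rightarrow> 'k"
  assumes scale_of_real: "smul (of_real r) x = r *\<^sub>R x"
    and ip_add_left: "ip (x + y) z = ip x z + ip y z"
    and ip_scale_left: "ip (smul c x) y = c * ip x y"
    and ip_commute: "to_complex (ip x y) = cnj (to_complex (ip y x))"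
    and ip_self: "ip x x = of_real ((norm x)\<^sup>2)"

lemma hilbert_space_real_inner:
  "hilbert_space (\<lambda>r (x::'a::{real_inner,banach}). r *\<^sub>R x) (\<lambda>x y. x \<bullet> y)"
  by unfold_locales
    (simp_all add: algebra_simps inner_commute to_complex_real_def power2_norm_eq_inner)

lemma hilbert_space_complex: "hilbert_space (*) (\<lambda>x y::complex. x * cnj y)"
proof unfold_locales
  show "x * cnj x = of_real ((norm x)\<^sup>2)" for x :: complex
    using complex_norm_square[of x] by simp
qed (simp_all add: algebra_simps to_complex_complex_def scaleR_conv_of_real)

definition bounded_operator ::
    "('k::real_or_complex \<Rightarrow> 'a::banach \<Rightarrow> 'a) \<Rightarrow> ('a \<Rightarrow> 'a) \<Rightarrow> bool" where
  "bounded_operator smul A \<longleftrightarrow>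
     Vector_Spaces.linear smul smul A \<and> (\<exists>K. \<forall>x. norm (A x) \<le> K * norm x)"

definition orthonormal_basis ::
    "('k::real_or_complex \<Rightarrow> 'a::banach \<Rightarrow> 'a) \<Rightarrow> ('a \<Rightarrow> 'a \<Rightarrow> 'k) \<Rightarrow> 'a set \<Rightarrow> bool" where
  "orthonormal_basis smul ip E \<longleftrightarrow>
     (\<forall>e\<in>E. \<forall>f\<in>E. ip e f = (if e = f then 1 else 0)) \<and>
     closure (module.span smul E) = UNIV"

(* For bounded operators the value does not depend on the orthonormal basis; for unbounded
   everywhere defined linear maps it would. *)
definition hs_norm ::
    "('k::real_or_complex \<Rightarrow> 'a::banach \<Rightarrow> 'a) \<Rightarrow> ('a \<Rightarrow> 'a \<Rightarrow> 'k) \<Rightarrow> ('a \<Rightarrow> 'a) \<Rightarrow> ennreal" where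
  "hs_norm smul ip A =
     (let E = (SOME E. orthonormal_basis smul ip E)
      in if (\<lambda>e. (norm (A e))\<^sup>2) summable_on E
         then ennreal (sqrt (\<Sum>\<^sub>\<infinity>e\<in>E. (norm (A e))\<^sup>2))
         else \<infinity>)"

definition commutator :: "('a \<Rightarrow> 'a) \<Rightarrow> ('a \<Rightarrow> 'a) \<Rightarrow> 'a \<Rightarrow> 'a::ab_group_add" where
  "commutator A B = (\<lambda>x. A (B x) - B (A x))"

end

theory Submission
  imports Defs "HOL-Library.Function_Algebras"
begin

text \<open>
  This is the Boettcher-Wenzel inequality.  Fix the orthonormal basis \<open>E\<close> with respect to which the
  Hilbert-Schmidt norm is computed.  By Parseval's identity the squared norm of an operator is the
  sum of the squared moduli of its matrix entries, and each entry of \<open>[A,B]\<close> is the limit of the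
  corresponding entry of the commutator of the \<open>F \<times> F\<close> blocks of \<open>A\<close> and \<open>B\<close>, as the finite set
  \<open>F \<subseteq> E\<close> grows.  So everything follows from the inequality for finite complex matrices,
  applied uniformly in \<open>F\<close>.

  For matrices \<open>X\<close>, \<open>Y\<close> the argument is Audenaert's variance bound, arranged so that nothing has to be
  diagonalised.  Put \<open>t = |Y|^2\<close>, \<open>D = YY* + Y*Y\<close> and \<open>Z = X*Y + YX*\<close>, and write
  \<open>p = tr((X*X + XX*)D)\<close>, \<open>m = |tr(XD)|^2\<close>, \<open>q = |DX + XD|^2\<close>.

  \<^item> Expanding gives \<open>|XY - YX|^2 + |Z|^2 = p\<close>.

  \<^item> Since \<open>tr(Y*Z) = tr(X*D)\<close>, Cauchy-Schwarz gives \<open>m \<le> t|Z|^2\<close>, so that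
    \<open>t|XY - YX|^2 \<le> tp - m\<close>.  The right-hand side is a noncommutative variance of \<open>X\<close> in the state
    with density matrix \<open>D/2t\<close>.

  \<^item> This variance is bounded by \<open>2t^2|X|^2\<close>, because \<open>4t^2|X|^2 - 2tp + 2m\<close> is the sum of
    \<open>|2tX - DX - XD|^2 = 4t^2|X|^2 - 4tp + q\<close> and of \<open>2tp + 2m - q\<close>.  The latter is nonnegative: with
    \<open>D = VV*\<close> and \<open>v_k\<close> the columns of \<open>V\<close> it is, up to a positive factor, the sum of the
    squared norms of \<open>Xv_k \<and> v_l + v_k \<and> Xv_l\<close> and of their analogues for \<open>X*\<close>
    (lemmas \<open>gram_inequality\<close> and \<open>density_inequality\<close>).

  The existence of an orthonormal basis has to be established as well: the Hilbert-Schmidt norm refers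
  to a basis picked by choice, about which nothing is known unless one exists.
\<close>

section \<open>Complex matrices over arbitrary index sets\<close>

text \<open>
  Matrices are functions of two indices, and the index set of each summation is an argument.  Thus
  an operator has one matrix, indexed by the whole basis, and passing to a finite block
  only changes the sets that are summed over.  Sums and differences of matrices are pointwise.
\<close>

definition mm :: "'j set \<Rightarrow> ('i \<Rightarrow> 'j \<Rightarrow> complex) \<Rightarrow> ('j \<Rightarrow> 'k \<Rightarrow> complex) \<Rightarrow> 'i \<Rightarrow> 'k \<Rightarrow> complex" where
  "mm J a b = (\<lambda>i k. \<Sum>j\<in>J. a i j * b j k)"

definition adj :: "('i \<Rightarrow> 'j \<Rightarrow> complex) \<Rightarrow> 'j \<Rightarrow> 'i \<Rightarrow> complex" where
  "adj a = (\<lambda>j i. cnj (a i j))"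

definition tr :: "'i set \<Rightarrow> ('i \<Rightarrow> 'i \<Rightarrow> complex) \<Rightarrow> complex" where
  "tr I a = (\<Sum>i\<in>I. a i i)"

text \<open>The square of the Hilbert-Schmidt (Frobenius) norm.\<close>

definition hsq :: "'i set \<Rightarrow> 'j set \<Rightarrow> ('i \<Rightarrow> 'j \<Rightarrow> complex) \<Rightarrow> real" where
  "hsq I J a = (\<Sum>i\<in>I. \<Sum>j\<in>J. (cmod (a i j))\<^sup>2)"

lemma mm_assoc: "mm J (mm I a b) c = mm I a (mm J b c)"
  unfolding mm_def
  by (auto simp: fun_eq_iff sum_distrib_left sum_distrib_right mult.assoc intro: sum.swap)

lemma mm_add_left: "mm J (a + b) c = mm J a c + mm J b c"
  and mm_add_right: "mm J a (b + c) = mm J a b + mm J a c"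
  and mm_diff_left: "mm J (a - b) c = mm J a c - mm J b c"
  and mm_diff_right: "mm J a (b - c) = mm J a b - mm J a c"
  by (simp_all add: mm_def fun_eq_iff algebra_simps sum.distrib sum_subtractf)

lemma adj_mm: "adj (mm J a b) = mm J (adj b) (adj a)"
  by (simp add: adj_def mm_def fun_eq_iff mult.commute)

lemma adj_add: "adj (a + b) = adj a + adj b"
  and adj_diff: "adj (a - b) = adj a - adj b"
  and adj_adj: "adj (adj a) = a"
  by (simp_all add: adj_def fun_eq_iff)

lemma tr_add: "tr I (a + b) = tr I a + tr I b"
  and tr_diff: "tr I (a - b) = tr I a - tr I b"
  and tr_adj: "tr I (adj a) = cnj (tr I a)"
  by (simp_all add: tr_def adj_def sum.distrib sum_subtractf)

lemma tr_mm_commute: "tr I (mm J a b) = tr J (mm I b a)"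
  unfolding tr_def mm_def by (subst sum.swap) (simp add: mult.commute)

lemma tr_adj_mm: "tr J (mm I (adj a) b) = (\<Sum>i\<in>I. \<Sum>j\<in>J. cnj (a i j) * b i j)"
  unfolding tr_def mm_def adj_def by (rule sum.swap)

lemma of_real_hsq: "of_real (hsq I J a) = tr J (mm I (adj a) a)"
  by (simp add: tr_adj_mm hsq_def mult.commute flip: complex_norm_square)

lemma hsq_tr: "hsq I J a = Re (tr J (mm I (adj a) a))"
  by (simp flip: of_real_hsq)

lemma hsq_nonneg: "0 \<le> hsq I J a"
  by (simp add: hsq_def sum_nonneg)

lemmas mat_simps = mm_assoc mm_add_left mm_add_right mm_diff_left mm_diff_right
  adj_mm adj_add adj_diff adj_adj tr_add tr_diff

text \<open>The pairing of \<open>a\<close> and \<open>b\<close> by \<open>tr (a* b)\<close> is the inner product of the vectors of entries, and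
  \<open>hsq\<close> is the associated squared norm.\<close>

lemma tr_Cauchy_Schwarz:
  "(cmod (tr J (mm I (adj a) b)))\<^sup>2 \<le> hsq I J a * hsq I J b"
proof -
  have "cmod (tr J (mm I (adj a) b)) \<le> (\<Sum>p\<in>I\<times>J. cmod (a (fst p) (snd p)) * cmod (b (fst p) (snd p)))"
    unfolding tr_adj_mm sum.cartesian_product
    by (rule order_trans[OF norm_sum]) (simp add: norm_mult case_prod_unfold)
  then have "(cmod (tr J (mm I (adj a) b)))\<^sup>2
      \<le> (\<Sum>p\<in>I\<times>J. cmod (a (fst p) (snd p)) * cmod (b (fst p) (snd p)))\<^sup>2"
    by (rule power_mono) simp
  also have "\<dots> \<le> (\<Sum>p\<in>I\<times>J. (cmod (a (fst p) (snd p)))\<^sup>2) * (\<Sum>p\<in>I\<times>J. (cmod (b (fst p) (snd p)))\<^sup>2)"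
    by (rule Cauchy_Schwarz_ineq_sum)
  also have "\<dots> = hsq I J a * hsq I J b"
    by (simp add: hsq_def sum.cartesian_product case_prod_unfold)
  finally show ?thesis .
qed

section \<open>The Boettcher-Wenzel inequality for matrices\<close>

text \<open>
  The next three lemmas compute the inner products of the families of tensors
  \<open>p\<^sub>k \<otimes> q\<^sub>l\<close> and \<open>p'\<^sub>k \<otimes> q'\<^sub>l\<close> of matrix columns, with the indices \<open>k\<close> and \<open>l\<close> in the same or in
  exchanged positions.  In the first case the tensor factors decouple; an exchange links them into
  a single trace.
\<close>

lemma sum_tensor_direct:
  "(\<Sum>k\<in>J. \<Sum>l\<in>J. \<Sum>a\<in>I. \<Sum>b\<in>I. p a k * q b l * (cnj (p' a k) * cnj (q' b l)))
     = tr J (mm I (adj p') p) * tr J (mm I (adj q') q)"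
proof -
  have "(\<Sum>a\<in>I. \<Sum>b\<in>I. p a k * q b l * (cnj (p' a k) * cnj (q' b l)))
     = mm I (adj p') p k k * mm I (adj q') q l l" for k l
    by (simp add: mm_def adj_def sum_product algebra_simps)
  then show ?thesis by (simp add: tr_def sum_product)
qed

lemma sum_tensor_crossed:
  "(\<Sum>k\<in>J. \<Sum>l\<in>J. \<Sum>a\<in>I. \<Sum>b\<in>I. p a k * q b l * (cnj (p' a l) * cnj (q' b k)))
     = tr J (mm J (mm I (adj p') p) (mm I (adj q') q))"
proof -
  have "(\<Sum>a\<in>I. \<Sum>b\<in>I. p a k * q b l * (cnj (p' a l) * cnj (q' b k)))
     = mm I (adj p') p l k * mm I (adj q') q k l" for k l
    by (simp add: mm_def adj_def sum_product algebra_simps)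
  then show ?thesis unfolding tr_def by (simp add: mm_def[of J]) (rule sum.swap)
qed

lemma sum_tensor_crossed':
  "(\<Sum>k\<in>J. \<Sum>l\<in>J. \<Sum>a\<in>I. \<Sum>b\<in>I. p a l * q b k * (cnj (p' a k) * cnj (q' b l)))
     = tr J (mm J (mm I (adj p') p) (mm I (adj q') q))"
  by (subst sum.swap) (rule sum_tensor_crossed)

text \<open>
  The difference of the two sides is a quarter of the sum over \<open>k\<close> and \<open>l\<close> of the squared norms of
  \<open>w\<^sub>k \<and> v\<^sub>l + v\<^sub>k \<and> w\<^sub>l\<close>, where \<open>x \<and> y\<close> is \<open>x \<otimes> y - y \<otimes> x\<close>.
\<close>

lemma gram_inequality:
  "Re (tr J (mm J (mm I (adj w) w) (mm I (adj v) v))) + hsq J J (mm I (adj v) w)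
     \<le> hsq I J w * hsq I J v + (cmod (tr J (mm I (adj v) w)))\<^sup>2"
proof -
  define T where "T k l a b = w a k * v b l + v a k * w b l - w a l * v b k - v a l * w b k" for k l a b
  define Z where "Z = (\<Sum>k\<in>J. \<Sum>l\<in>J. \<Sum>a\<in>I. \<Sum>b\<in>I. T k l a b * cnj (T k l a b))"
  \<comment> \<open>\<open>T\<close> changes sign when \<open>k\<close> and \<open>l\<close> are exchanged, so both halves of \<open>T\<close> contribute equally to \<open>Z\<close>.\<close>
  have flip: "(\<Sum>k\<in>J. \<Sum>l\<in>J. \<Sum>a\<in>I. \<Sum>b\<in>I. T k l a b * cnj (w a l * v b k + v a l * w b k))
     = - (\<Sum>k\<in>J. \<Sum>l\<in>J. \<Sum>a\<in>I. \<Sum>b\<in>I. T k l a b * cnj (w a k * v b l + v a k * w b l))"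
    by (subst sum.swap) (simp add: T_def algebra_simps flip: sum_negf)
  define P where "P = mm I (adj v) v"
  define S where "S = mm I (adj w) w"
  define Q where "Q = mm I (adj v) w"
  have adjQ: "mm I (adj w) v = adj Q" by (simp add: Q_def mat_simps)
  have "Z = (\<Sum>k\<in>J. \<Sum>l\<in>J. \<Sum>a\<in>I. \<Sum>b\<in>I. T k l a b * cnj (w a k * v b l + v a k * w b l))
     - (\<Sum>k\<in>J. \<Sum>l\<in>J. \<Sum>a\<in>I. \<Sum>b\<in>I. T k l a b * cnj (w a l * v b k + v a l * w b k))"
    unfolding Z_def sum_subtractf[symmetric] by (intro sum.cong refl) (simp add: T_def algebra_simps)
  also have "\<dots> = 2 * (\<Sum>k\<in>J. \<Sum>l\<in>J. \<Sum>a\<in>I. \<Sum>b\<in>I. T k l a b * cnj (w a k * v b l + v a k * w b l))"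
    unfolding flip by simp
  also have "(\<Sum>k\<in>J. \<Sum>l\<in>J. \<Sum>a\<in>I. \<Sum>b\<in>I. T k l a b * cnj (w a k * v b l + v a k * w b l))
    = (\<Sum>k\<in>J. \<Sum>l\<in>J. \<Sum>a\<in>I. \<Sum>b\<in>I.
        w a k * v b l * (cnj (w a k) * cnj (v b l)) + w a k * v b l * (cnj (v a k) * cnj (w b l))
      + v a k * w b l * (cnj (w a k) * cnj (v b l)) + v a k * w b l * (cnj (v a k) * cnj (w b l)))
    - (\<Sum>k\<in>J. \<Sum>l\<in>J. \<Sum>a\<in>I. \<Sum>b\<in>I.
        w a l * v b k * (cnj (w a k) * cnj (v b l)) + w a l * v b k * (cnj (v a k) * cnj (w b l))
      + v a l * w b k * (cnj (w a k) * cnj (v b l)) + v a l * w b k * (cnj (v a k) * cnj (w b l)))"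
    unfolding sum_subtractf[symmetric] by (intro sum.cong refl) (simp add: T_def algebra_simps)
  also have "\<dots> = 2 * tr J S * tr J P + 2 * (tr J Q * tr J (adj Q))
     - (tr J (mm J S P) + tr J (mm J P S) + tr J (mm J Q (adj Q)) + tr J (mm J (adj Q) Q))"
    by (simp only: sum.distrib sum_tensor_direct sum_tensor_crossed sum_tensor_crossed' adjQ
          flip: P_def S_def Q_def) (simp add: algebra_simps)
  also have "\<dots> = 2 * (tr J S * tr J P + tr J Q * cnj (tr J Q) - tr J (mm J S P) - tr J (mm J (adj Q) Q))"
    by (simp add: tr_adj tr_mm_commute[of J J P S] tr_mm_commute[of J J Q "adj Q"])
  also have "\<dots> = 2 * (of_real (hsq I J w * hsq I J v + (cmod (tr J Q))\<^sup>2 - hsq J J Q) - tr J (mm J S P))"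
    by (simp add: S_def P_def flip: of_real_hsq complex_norm_square)
  finally have "Re Z = 4 * (hsq I J w * hsq I J v + (cmod (tr J Q))\<^sup>2 - hsq J J Q - Re (tr J (mm J S P)))"
    by simp
  moreover have "Z = of_real (\<Sum>k\<in>J. \<Sum>l\<in>J. \<Sum>a\<in>I. \<Sum>b\<in>I. (cmod (T k l a b))\<^sup>2)"
    unfolding Z_def by (simp flip: complex_norm_square)
  then have "0 \<le> Re Z" by (simp add: sum_nonneg)
  ultimately show ?thesis by (simp add: S_def P_def Q_def)
qed

text \<open>
  The Gram inequality for \<open>w = xv\<close>, with all traces moved to the index set \<open>I\<close>.  The factor \<open>v\<close> enters only
  through the positive semidefinite matrix \<open>D\<close>.  For a diagonal matrix \<open>D\<close> with entries \<open>p\<^sub>i\<close> the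
  difference of the two sides is the sum of \<open>p\<^sub>i p\<^sub>j |x\<^sub>i\<^sub>i + x\<^sub>j\<^sub>j|^2\<close> over all \<open>i < j\<close>, plus nonnegative
  multiples of the squared moduli of the off-diagonal entries of \<open>x\<close>.
\<close>

lemma density_inequality:
  assumes D: "D = mm J v (adj v)"
  shows "Re (tr I (mm I (adj x) (mm I x (mm I D D)))) + Re (tr I (mm I (adj x) (mm I D (mm I x D))))
    \<le> Re (tr I D) * Re (tr I (mm I (adj x) (mm I x D))) + (cmod (tr I (mm I x D)))\<^sup>2"
proof -
  define w where "w = mm I x v"
  have 1: "tr J (mm J (mm I (adj w) w) (mm I (adj v) v)) = tr I (mm I (adj x) (mm I x (mm I D D)))"
    unfolding w_def D mat_simps by (subst tr_mm_commute) (simp add: mat_simps)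
  have 2: "hsq J J (mm I (adj v) w) = Re (tr I (mm I (adj x) (mm I D (mm I x D))))"
    unfolding w_def D hsq_tr mat_simps by (subst tr_mm_commute) (simp add: mat_simps)
  have 3: "hsq I J w = Re (tr I (mm I (adj x) (mm I x D)))"
    unfolding w_def D hsq_tr mat_simps by (subst tr_mm_commute) (simp add: mat_simps)
  have 4: "hsq I J v = Re (tr I D)"
    unfolding D hsq_tr by (subst tr_mm_commute) simp
  have 5: "tr J (mm I (adj v) w) = tr I (mm I x D)"
    unfolding w_def D mat_simps by (subst tr_mm_commute) (simp add: mat_simps)
  show ?thesis using gram_inequality[of J I w v] unfolding 1 2 3 4 5 by (simp add: mult.commute)
qed

lemma hsq_scale_diff:
  "hsq I J ((\<lambda>i j. of_real c * a i j) - b) = c\<^sup>2 * hsq I J a - 2 * c * Re (tr J (mm I (adj b) a)) + hsq I J b"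
proof -
  have "(cmod (of_real c * a i j - b i j))\<^sup>2
     = c\<^sup>2 * (cmod (a i j))\<^sup>2 - 2 * c * Re (cnj (b i j) * a i j) + (cmod (b i j))\<^sup>2" for i j
    unfolding cmod_power2 by (simp add: power2_eq_square algebra_simps)
  then show ?thesis
    by (simp only: hsq_def tr_adj_mm sum.distrib sum_subtractf Re_sum minus_apply flip: sum_distrib_left)
qed

lemma bottcher_wenzel_matrix:
  assumes "finite I"
  shows "hsq I I (mm I x y - mm I y x) \<le> 2 * hsq I I x * hsq I I y"
proof -
  define t where "t = hsq I I y"
  define D where "D = mm I y (adj y) + mm I (adj y) y"
  \<comment> \<open>The columns of \<open>y\<close> followed by those of its adjoint: the block matrix \<open>v = [y, y*]\<close> satisfies \<open>D = vv*\<close>.\<close>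
  define v where "v = (\<lambda>i. case_sum (y i) (adj y i))"
  have DV: "D = mm (I <+> I) v (adj v)"
    using assms by (auto simp: D_def v_def mm_def adj_def fun_eq_iff sum.Plus)
  have adjD: "adj D = D" by (simp add: D_def mat_simps add.commute)
  have trD: "Re (tr I D) = 2 * t"
    by (simp add: D_def tr_add tr_mm_commute[of I I y] t_def hsq_tr)
  define p where "p = Re (tr I (mm I (adj x) (mm I x D))) + Re (tr I (mm I x (mm I (adj x) D)))"
  define q where "q = hsq I I (mm I D x + mm I x D)"
  define m where "m = (cmod (tr I (mm I x D)))\<^sup>2"
  have tx: "cmod (tr I (mm I (adj x) D)) = cmod (tr I (mm I x D))"
    using tr_adj[of I "mm I x D"] tr_mm_commute[of I I D "adj x"] by (simp add: mat_simps adjD)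
  have q: "q = Re (tr I (mm I (adj x) (mm I x (mm I D D)))) + Re (tr I (mm I x (mm I (adj x) (mm I D D))))
    + 2 * Re (tr I (mm I (adj x) (mm I D (mm I x D))))"
    using tr_mm_commute[of I I D "mm I (adj x) (mm I x D)"]
      tr_mm_commute[of I I D "mm I (adj x) (mm I D x)"]
      tr_mm_commute[of I I "mm I (adj x) (mm I D D)" x]
    by (simp add: q_def hsq_tr mat_simps adjD)
  \<comment> \<open>The sum of the density inequalities for \<open>x\<close> and for its adjoint.\<close>
  have R: "q \<le> 2 * t * p + 2 * m"
    using density_inequality[OF DV, where I=I and x=x] density_inequality[OF DV, where I=I and x="adj x"]
      tr_mm_commute[of I I "mm I x D" "mm I (adj x) D"]
    by (simp add: q p_def m_def tx trD adj_adj mat_simps algebra_simps)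
  have "tr I (mm I (adj (mm I D x + mm I x D)) x) = tr I (mm I x (mm I (adj x) D)) + tr I (mm I (adj x) (mm I x D))"
    using tr_mm_commute[of I I "mm I (adj x) D" x] tr_mm_commute[of I I D "mm I (adj x) x"]
    by (simp add: mat_simps adjD)
  then have "hsq I I ((\<lambda>i j. of_real (2 * t) * x i j) - (mm I D x + mm I x D))
    = 4 * t\<^sup>2 * hsq I I x - 4 * t * p + q"
    unfolding hsq_scale_diff by (simp add: q_def p_def power2_eq_square)
  then have S: "0 \<le> 4 * t\<^sup>2 * hsq I I x - 4 * t * p + q"
    by (metis hsq_nonneg)
  \<comment> \<open>The variance bound.\<close>
  have var: "t * p - m \<le> 2 * t\<^sup>2 * hsq I I x" using R S by simp
  define z where "z = mm I (adj x) y + mm I y (adj x)"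
  have split: "hsq I I (mm I x y - mm I y x) + hsq I I z = p"
  proof -
    \<comment> \<open>The mixed terms \<open>tr (y* x* y x)\<close> and \<open>tr (x* y* x y)\<close> have coefficient \<open>-1\<close> in the first summand, \<open>1\<close> in the second.\<close>
    have "tr I (mm I (adj (mm I x y - mm I y x)) (mm I x y - mm I y x)) + tr I (mm I (adj z) z)
      = tr I (mm I (adj x) (mm I x D)) + tr I (mm I x (mm I (adj x) D))"
      using tr_mm_commute[of I I "adj y" "mm I (adj x) (mm I x y)"]
        tr_mm_commute[of I I "mm I (adj x) (mm I (adj y) y)" x]
        tr_mm_commute[of I I "adj y" "mm I x (mm I (adj x) y)"]
        tr_mm_commute[of I I "adj y" "mm I x (mm I y (adj x))"]
        tr_mm_commute[of I I "mm I x (mm I (adj y) y)" "adj x"]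
        tr_mm_commute[of I I "mm I x (mm I (adj y) (mm I (adj x) y))"]
        tr_mm_commute[of I I x "mm I (adj y) (mm I (adj x) y)"]
        tr_mm_commute[of I I "adj x" "mm I (adj y) (mm I x y)"]
        tr_mm_commute[of I I "adj y" "mm I (adj x) (mm I y x)"]
      by (simp add: z_def D_def mat_simps)
    then show ?thesis by (simp add: hsq_tr p_def flip: plus_complex.sel)
  qed
  have cs: "m \<le> t * hsq I I z"
  proof -
    have "tr I (mm I (adj y) z) = tr I (mm I (adj x) D)"
      using tr_mm_commute[of I I "adj y" "mm I (adj x) y"] tr_mm_commute[of I I "mm I (adj y) y" "adj x"]
      by (simp add: z_def D_def mat_simps)
    then show ?thesis using tr_Cauchy_Schwarz[of I I y z] by (simp add: m_def t_def tx)
  qed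
  show ?thesis
  proof (cases "t = 0")
    case True
    then have "y i j = 0" if "i \<in> I" "j \<in> I" for i j
      using that assms by (auto simp: t_def hsq_def sum_nonneg_eq_0_iff sum_nonneg)
    then have "hsq I I (mm I x y - mm I y x) = 0"
      by (simp add: hsq_def mm_def)
    then show ?thesis using True by (simp add: t_def)
  next
    case False
    then have t: "0 < t" using hsq_nonneg[of I I y] by (simp add: t_def)
    have "t * hsq I I (mm I x y - mm I y x) = t * p - t * hsq I I z"
      by (simp add: algebra_simps flip: split)
    also have "\<dots> \<le> t * (2 * hsq I I x * t)"
      using var cs by (simp add: power2_eq_square algebra_simps)
    finally show ?thesis using t by (simp add: t_def)
  qed
qed

section \<open>Orthonormal sets and bases in a Hilbert space\<close>

context hilbert_space
begin

text \<open>
  Reading the inner product as a complex number gives conjugate symmetry its usual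
  form and treats real and complex scalars alike.
\<close>

definition cip :: "'a \<Rightarrow> 'a \<Rightarrow> complex" where
  "cip x y = to_complex (ip x y)"

lemma cip_add_left: "cip (x + y) z = cip x z + cip y z"
  by (simp add: cip_def ip_add_left to_complex_add)

lemma cip_scale_left: "cip (smul c x) y = to_complex c * cip x y"
  by (simp add: cip_def ip_scale_left to_complex_mult)

lemma cip_commute: "cip x y = cnj (cip y x)"
  by (simp add: cip_def ip_commute[of x y])

lemma cip_self: "cip x x = of_real ((norm x)\<^sup>2)"
  by (simp only: cip_def ip_self to_complex_of_real)

lemma cmod_cip: "cmod (cip x y) = norm (ip x y)"
  by (simp add: cip_def norm_to_complex)

lemma cip_zero_left: "cip 0 z = 0"
  using cip_add_left[of 0 0 z] by simp

lemma cip_diff_left: "cip (x - y) z = cip x z - cip y z"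
  using cip_add_left[of "x - y" y z] by simp

lemma cip_sum_left: "cip (\<Sum>i\<in>I. f i) z = (\<Sum>i\<in>I. cip (f i) z)"
  by (induction I rule: infinite_finite_induct) (simp_all add: cip_zero_left cip_add_left)

lemma norm_smul: "norm (smul c x) = norm c * norm x"
proof -
  have "cip x (smul c x) = cnj (to_complex c) * cip x x"
    by (subst cip_commute) (simp add: cip_scale_left cip_self)
  then have "of_real ((norm (smul c x))\<^sup>2) = to_complex c * cnj (to_complex c) * cip x x"
    by (simp only: cip_self[symmetric] cip_scale_left mult.assoc)
  also have "\<dots> = of_real ((norm c * norm x)\<^sup>2)"
    by (simp add: cip_self norm_to_complex power_mult_distrib flip: complex_norm_square)
  finally have "(norm (smul c x))\<^sup>2 = (norm c * norm x)\<^sup>2"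
    by (simp only: of_real_eq_iff)
  then show ?thesis by simp
qed

lemma pythagoras:
  assumes "cip x y = 0"
  shows "(norm (x + y))\<^sup>2 = (norm x)\<^sup>2 + (norm y)\<^sup>2"
proof -
  have yx: "cip y x = 0" using assms cip_commute[of y x] by simp
  have "cip x (x + y) = cip x x" "cip y (x + y) = cip y y"
    by (subst cip_commute, simp add: cip_add_left assms yx, metis cip_commute)+
  then have "cip (x + y) (x + y) = cip x x + cip y y"
    by (simp add: cip_add_left)
  then have "complex_of_real ((norm (x + y))\<^sup>2) = of_real ((norm x)\<^sup>2 + (norm y)\<^sup>2)"
    by (simp only: cip_self of_real_add)
  then show ?thesis by (simp only: of_real_eq_iff)
qed

definition orthonormal :: "'a set \<Rightarrow> bool" where
  "orthonormal E \<longleftrightarrow> (\<forall>e\<in>E. \<forall>f\<in>E. ip e f = (if e = f then 1 else 0))"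

lemma orthonormal_subset: "orthonormal E \<Longrightarrow> F \<subseteq> E \<Longrightarrow> orthonormal F"
  by (simp add: orthonormal_def subset_iff)

lemma orthonormal_basis_iff:
  "orthonormal_basis smul ip E \<longleftrightarrow> orthonormal E \<and> closure (span E) = UNIV"
  unfolding orthonormal_basis_def orthonormal_def ..

lemma cip_orthonormal:
  assumes "orthonormal E" "e \<in> E" "f \<in> E"
  shows "cip e f = (if e = f then 1 else 0)"
  using assms to_complex_of_real[of 1, where 'k='k] to_complex_of_real[of 0, where 'k='k]
  by (simp add: orthonormal_def cip_def)

text \<open>For a finite orthonormal set \<open>F\<close> this is the orthogonal projection onto the span of \<open>F\<close>.\<close>

definition proj :: "'a set \<Rightarrow> 'a \<Rightarrow> 'a" where
  "proj F x = (\<Sum>e\<in>F. smul (ip x e) e)"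

lemma cip_proj: "cip (proj F x) z = (\<Sum>e\<in>F. cip x e * cip e z)"
  by (simp add: proj_def cip_sum_left cip_scale_left) (simp add: cip_def)

lemma cip_proj_mem:
  assumes "orthonormal F" "finite F" "e \<in> F"
  shows "cip (proj F x) e = cip x e"
proof -
  have "cip (proj F x) e = (\<Sum>g\<in>F. if g = e then cip x g else 0)"
    unfolding cip_proj by (intro sum.cong) (auto simp: cip_orthonormal[OF assms(1) _ assms(3)])
  then show ?thesis using assms by simp
qed

lemma norm_proj:
  assumes "orthonormal F" "finite F"
  shows "(norm (proj F x))\<^sup>2 = (\<Sum>e\<in>F. (norm (ip x e))\<^sup>2)"
proof -
  have "cip (proj F x) (proj F x) = (\<Sum>e\<in>F. cip x e * cnj (cip x e))"
    by (subst cip_proj, intro sum.cong refl)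
      (subst (2) cip_commute, simp add: cip_proj_mem[OF assms])
  also have "\<dots> = of_real (\<Sum>e\<in>F. (norm (ip x e))\<^sup>2)"
    by (simp add: cmod_cip flip: complex_norm_square)
  finally show ?thesis by (simp only: cip_self of_real_eq_iff)
qed

lemma norm_diff_proj:
  assumes "orthonormal F" "finite F"
  shows "(norm (x - proj F x))\<^sup>2 = (norm x)\<^sup>2 - (\<Sum>e\<in>F. (norm (ip x e))\<^sup>2)"
proof -
  have 0: "cip e (x - proj F x) = 0" if "e \<in> F" for e
    by (subst cip_commute) (simp add: cip_diff_left cip_proj_mem[OF assms that])
  have "cip (proj F x) (x - proj F x) = 0"
    unfolding cip_proj by (simp add: 0)
  from pythagoras[OF this] show ?thesis
    by (simp add: norm_proj[OF assms])
qed

lemma Bessel: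
  assumes "orthonormal F" "finite F"
  shows "(\<Sum>e\<in>F. (norm (ip x e))\<^sup>2) \<le> (norm x)\<^sup>2"
  using norm_diff_proj[OF assms, of x] zero_le_power2[of "norm (x - proj F x)"] by linarith

lemma bounded_linear_cip:
  assumes "orthonormal E" "e \<in> E"
  shows "bounded_linear (\<lambda>x. cip x e)"
proof (rule bounded_linear_intro[where K=1])
  show "cip (r *\<^sub>R x) e = r *\<^sub>R cip x e" for r x
    by (simp add: cip_scale_left to_complex_of_real scaleR_conv_of_real flip: scale_of_real)
  show "norm (cip x e) \<le> norm x * 1" for x
  proof -
    have "orthonormal {e}" using assms orthonormal_subset by blast
    from Bessel[OF this, of x] show ?thesis
      by (simp add: cmod_cip power_mono_iff)
  qed
qed (rule cip_add_left)

lemma bounded_linear_bounded_operator: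
  assumes "bounded_operator smul A"
  shows "bounded_linear A"
proof -
  from assms obtain K where lin: "Vector_Spaces.linear smul smul A"
    and K: "\<And>x. norm (A x) \<le> K * norm x"
    by (auto simp: bounded_operator_def)
  interpret Vector_Spaces.linear smul smul A by (fact lin)
  show ?thesis
    by (rule bounded_linear_intro[where K=K])
      (simp_all add: add K mult.commute scale flip: scale_of_real)
qed

text \<open>
  By Bessel's inequality the squared coefficients are summable, and by Pythagoras the squared
  distance of two partial sums of the expansion, one of which extends the other, is a partial sum of
  squared coefficients.  Hence the partial sums form a Cauchy filter.  Absolute summability is not available here,
  since the coefficients are only square summable.
\<close>

lemma expansion_summable:
  assumes "orthonormal E"
  shows "(\<lambda>e. smul (ip x e) e) summable_on E"
proof -
  define a where "a e = (norm (ip x e))\<^sup>2" for e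
  have fin: "orthonormal F" if "F \<subseteq> E" for F
    using assms that by (rule orthonormal_subset)
  have "a summable_on E"
    by (rule nonneg_bdd_above_summable_on)
      (auto simp: a_def bdd_above_def intro!: exI[of _ "(norm x)\<^sup>2"] Bessel fin)
  then have lim: "(sum a \<longlongrightarrow> infsum a E) (finite_subsets_at_top E)"
    using has_sum_infsum has_sum_def by blast
  have le: "sum a F \<le> infsum a E" if "finite F" "F \<subseteq> E" for F
    by (rule finite_sum_le_infsum) (use that \<open>a summable_on E\<close> in \<open>auto simp: a_def\<close>)
  have "\<exists>P. eventually P (finite_subsets_at_top E) \<and>
      (\<forall>F G. P F \<and> P G \<longrightarrow> dist (proj F x) (proj G x) < \<epsilon>)" if "0 < \<epsilon>" for \<epsilon>
  proof (intro exI conjI allI impI)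
    define P where "P F \<longleftrightarrow> finite F \<and> F \<subseteq> E \<and> infsum a E - (\<epsilon> / 2)\<^sup>2 < sum a F" for F
    have "eventually (\<lambda>F. infsum a E - (\<epsilon> / 2)\<^sup>2 < sum a F) (finite_subsets_at_top E)"
      by (rule order_tendstoD(1)[OF lim]) (use that in simp)
    then show "eventually P (finite_subsets_at_top E)"
      unfolding P_def
      by (intro eventually_conj) (auto intro: eventually_finite_subsets_at_top_weakI)
    fix F G assume FG: "P F \<and> P G"
    have near: "dist (proj (F \<union> G) x) (proj F' x) < \<epsilon> / 2" if "F' \<subseteq> F \<union> G" "P F'" for F'
    proof -
      have fG: "finite (F \<union> G)" "F \<union> G \<subseteq> E" using FG by (auto simp: P_def)
      have "proj (F \<union> G) x - proj F' x = proj (F \<union> G - F') x"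
        unfolding proj_def using that fG by (simp add: sum_diff)
      then have "(dist (proj (F \<union> G) x) (proj F' x))\<^sup>2 = sum a (F \<union> G - F')"
        unfolding dist_norm a_def using fG by (subst norm_proj[symmetric]) (auto intro!: fin)
      also have "\<dots> = sum a (F \<union> G) - sum a F'"
        using that fG by (simp add: sum_diff)
      also have "\<dots> < (\<epsilon> / 2)\<^sup>2"
        using le[OF fG] \<open>P F'\<close> by (simp add: P_def)
      finally show ?thesis
        by (rule power_less_imp_less_base) (use \<open>0 < \<epsilon>\<close> in simp)
    qed
    show "dist (proj F x) (proj G x) < \<epsilon>"
      using near[of F] near[of G] FG dist_triangle3[of "proj F x" "proj G x" "proj (F \<union> G) x"] by simp
  qed
  then have "cauchy_filter (filtermap (\<lambda>F. proj F x) (finite_subsets_at_top E))"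
    by (simp add: cauchy_filter_metric_filtermap)
  moreover have "complete (UNIV :: 'a set)"
    by (meson Cauchy_convergent UNIV_I complete_def convergent_def)
  ultimately obtain y where "((\<lambda>F. proj F x) \<longlongrightarrow> y) (finite_subsets_at_top E)"
    using complete_uniform[where S=UNIV] by (force simp add: filterlim_def)
  then show ?thesis
    unfolding summable_on_def has_sum_def proj_def by blast
qed

lemma sum_in_closure_span:
  assumes "((\<lambda>e. smul (c e) e) has_sum y) E"
  shows "y \<in> closure (span E)"
proof (rule Lim_in_closed_set)
  show "((\<lambda>F. \<Sum>e\<in>F. smul (c e) e) \<longlongrightarrow> y) (finite_subsets_at_top E)"
    using assms by (simp add: has_sum_def)
  show "eventually (\<lambda>F. (\<Sum>e\<in>F. smul (c e) e) \<in> closure (span E)) (finite_subsets_at_top E)"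
    by (rule eventually_finite_subsets_at_top_weakI)
      (auto intro!: subsetD[OF closure_subset] span_sum span_scale intro: span_base)
qed simp_all

lemma ex_maximal_orthonormal:
  "\<exists>E. orthonormal E \<and> (\<forall>X. orthonormal X \<longrightarrow> E \<subseteq> X \<longrightarrow> X = E)"
proof -
  have "\<exists>E\<in>Collect orthonormal. \<forall>X\<in>Collect orthonormal. E \<subseteq> X \<longrightarrow> X = E"
  proof (rule subset_Zorn')
    fix C assume C: "subset.chain (Collect orthonormal) C"
    have "ip e f = (if e = f then 1 else 0)" if ef: "e \<in> \<Union>C" "f \<in> \<Union>C" for e f
    proof -
      obtain X Y where XY: "X \<in> C" "Y \<in> C" "e \<in> X" "f \<in> Y" using ef by blast
      with C have "X \<subseteq> Y \<or> Y \<subseteq> X" unfolding subset_chain_def by blast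
      with XY obtain Z where Z: "Z \<in> C" "e \<in> Z" "f \<in> Z" by blast
      with C have "orthonormal Z" unfolding subset_chain_def by blast
      with Z show ?thesis unfolding orthonormal_def by blast
    qed
    then show "\<Union>C \<in> Collect orthonormal" unfolding mem_Collect_eq orthonormal_def by blast
  qed
  then show ?thesis by simp
qed

lemma diff_sum_orthogonal:
  assumes E: "orthonormal E" "e \<in> E" and y: "((\<lambda>g. smul (ip x g) g) has_sum y) E"
  shows "cip (x - y) e = 0"
proof -
  have "((\<lambda>g. cip (smul (ip x g) g) e) has_sum cip y e) E"
    by (rule has_sum_bounded_linear[OF bounded_linear_cip[OF E] y])
  moreover have "cip (smul (ip x g) g) e = (if g = e then cip x e else 0)" if "g \<in> E" for g
    unfolding cip_scale_left cip_orthonormal[OF E(1) that E(2)] by (simp add: cip_def)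
  ultimately have "((\<lambda>g. if g = e then cip x e else 0) has_sum cip y e) E"
    by (simp cong: has_sum_cong)
  moreover have "((\<lambda>g. if g = e then cip x e else 0) has_sum cip x e) E"
    by (rule has_sum_finite_neutralI[of "{e}"]) (use E(2) in auto)
  ultimately have "cip x e = cip y e" by (metis has_sum_unique)
  then show ?thesis by (simp add: cip_diff_left)
qed

text \<open>A nonzero vector orthogonal to \<open>E\<close>, once normalised, could be added to \<open>E\<close>.\<close>

lemma maximal_orthonormal_orthogonal_zero:
  assumes E: "orthonormal E" and maximal: "\<And>X. orthonormal X \<Longrightarrow> E \<subseteq> X \<Longrightarrow> X = E"
    and z: "\<And>e. e \<in> E \<Longrightarrow> cip z e = 0"
  shows "z = 0"
proof (rule ccontr)
  assume "z \<noteq> 0"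
  define u where "u = smul (of_real (inverse (norm z))) z"
  have "norm u = 1" using \<open>z \<noteq> 0\<close> by (simp add: u_def norm_smul norm_inverse)
  then have uu: "ip u u = 1" by (simp add: ip_self)
  have "cip u e = 0" if "e \<in> E" for e
    unfolding u_def cip_scale_left using z[OF that] by simp
  then have ue: "ip u e = 0" "ip e u = 0" if "e \<in> E" for e
    using that cmod_cip[of u e] cmod_cip[of e u] cip_commute[of e u] by simp_all
  have "u \<notin> E" using uu ue(1)[of u] by auto
  have "ip e f = (if e = f then 1 else 0)" if "e \<in> insert u E" "f \<in> insert u E" for e f
  proof (cases "e \<in> E \<and> f \<in> E")
    case True
    then show ?thesis using E unfolding orthonormal_def by blast
  next
    case False
    with that uu ue \<open>u \<notin> E\<close> show ?thesis by auto
  qed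
  then have "orthonormal (insert u E)" unfolding orthonormal_def by blast
  with maximal[of "insert u E"] \<open>u \<notin> E\<close> show False by blast
qed

text \<open>
  A maximal orthonormal set \<open>E\<close> is a basis: the expansion of \<open>x\<close> along \<open>E\<close> converges to a point \<open>y\<close> of the
  closed span, and \<open>x - y\<close> is orthogonal to \<open>E\<close>, hence zero.
\<close>

lemma ex_orthonormal_basis: "\<exists>E. orthonormal_basis smul ip E"
proof -
  obtain E where "orthonormal E \<and> (\<forall>X. orthonormal X \<longrightarrow> E \<subseteq> X \<longrightarrow> X = E)"
    using ex_maximal_orthonormal ..
  then have E: "orthonormal E"
    and maximal: "\<And>X. orthonormal X \<Longrightarrow> E \<subseteq> X \<Longrightarrow> X = E" by simp_all
  have "x \<in> closure (span E)" for x
  proof -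
    obtain y where y: "((\<lambda>e. smul (ip x e) e) has_sum y) E"
      using expansion_summable[OF E, of x] unfolding summable_on_def ..
    have "x - y = 0"
      by (rule maximal_orthonormal_orthogonal_zero[OF E maximal diff_sum_orthogonal[OF E _ y]])
    then have "x = y" by (simp only: right_minus_eq)
    then show ?thesis using sum_in_closure_span[OF y] by (rule ssubst)
  qed
  then have "closure (span E) = UNIV" by (rule UNIV_eq_I[symmetric])
  with E have "orthonormal_basis smul ip E" by (rule orthonormal_basis_iff[THEN iffD2, OF conjI])
  then show ?thesis by (rule exI[of _ E])
qed

lemma proj_span:
  assumes "orthonormal F" "finite F" "y \<in> span F"
  shows "proj F y = y"
  using assms(3)
proof (induction rule: span_induct_alt)
  case base
  have "ip 0 e = 0" for e
    using cmod_cip[of 0 e] by (simp add: cip_zero_left)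
  then show ?case by (simp add: proj_def)
next
  case (step c f z)
  have "proj F (smul c f + z) = smul c (proj F f) + proj F z"
    unfolding proj_def ip_add_left ip_scale_left scale_left_distrib sum.distrib scale_sum_right
    by (simp only: scale_scale)
  also have "proj F f = (\<Sum>e\<in>F. if e = f then f else 0)"
    unfolding proj_def
    by (intro sum.cong refl) (use assms(1) step.hyps in \<open>simp add: orthonormal_def\<close>)
  also have "\<dots> = f" using step.hyps assms(2) by simp
  finally show ?case using step.IH by simp
qed

text \<open>
  If \<open>y\<close> lies in the span of a finite subset of \<open>E\<close>, then for every larger finite subset \<open>F\<close> the
  projection of \<open>x\<close> is at least as close to \<open>x\<close> as \<open>y\<close> is.  By density, \<open>y\<close> can be chosen as close to
  \<open>x\<close> as desired.
\<close>

lemma orthonormal_expansion: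
  assumes "orthonormal_basis smul ip E"
  shows "((\<lambda>e. smul (ip x e) e) has_sum x) E"
proof -
  have E: "orthonormal E" and dense: "closure (span E) = UNIV"
    using assms unfolding orthonormal_basis_iff by blast+
  show ?thesis unfolding has_sum_def
  proof (rule tendstoI)
    fix \<epsilon> :: real assume "0 < \<epsilon>"
    with dense obtain y where y: "y \<in> span E" "dist y x < \<epsilon>"
      by (metis UNIV_I closure_approachable)
    from y(1) obtain F0 c where F0: "finite F0" "F0 \<subseteq> E" and "y = (\<Sum>e\<in>F0. smul (c e) e)"
      unfolding span_explicit by blast
    then have yF0: "y \<in> span F0" by (simp add: span_sum span_scale span_base)
    show "eventually (\<lambda>F. dist (\<Sum>e\<in>F. smul (ip x e) e) x < \<epsilon>) (finite_subsets_at_top E)"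
      unfolding eventually_finite_subsets_at_top
    proof (intro exI[of _ F0] conjI allI impI F0)
      fix F assume F: "finite F \<and> F0 \<subseteq> F \<and> F \<subseteq> E"
      then have on: "orthonormal F" "finite F" using E orthonormal_subset by auto
      have "y \<in> span F" using F yF0 span_mono by blast
      then have "proj F (x - y) = proj F x - y"
        using proj_span[OF on, of y] ip_add_left[of "x - y" y]
        by (simp add: proj_def scale_left_distrib sum.distrib)
      then have "(norm (x - proj F x))\<^sup>2 = (norm (x - y))\<^sup>2 - (\<Sum>e\<in>F. (norm (ip (x - y) e))\<^sup>2)"
        using norm_diff_proj[OF on, of "x - y"] by simp
      also have "\<dots> \<le> (norm (x - y))\<^sup>2" by (simp add: sum_nonneg)
      finally have "norm (x - proj F x) \<le> norm (x - y)"
        by (rule power2_le_imp_le) simp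
      then show "dist (\<Sum>e\<in>F. smul (ip x e) e) x < \<epsilon>"
        using y(2) by (simp add: proj_def dist_norm norm_minus_commute)
    qed
  qed
qed

lemma Parseval:
  assumes "orthonormal_basis smul ip E"
  shows "((\<lambda>e. (norm (ip x e))\<^sup>2) has_sum (norm x)\<^sup>2) E"
proof -
  have "orthonormal F" if "F \<subseteq> E" for F
    using assms that unfolding orthonormal_basis_iff by (blast intro: orthonormal_subset)
  moreover have "((\<lambda>F. (norm (proj F x))\<^sup>2) \<longlongrightarrow> (norm x)\<^sup>2) (finite_subsets_at_top E)"
    using orthonormal_expansion[OF assms, of x] unfolding has_sum_def proj_def
    by (intro tendsto_intros)
  ultimately show ?thesis unfolding has_sum_def
    by (elim Lim_transform_eventually)
      (auto intro!: eventually_finite_subsets_at_top_weakI norm_proj)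
qed

section \<open>Passing from finite blocks to operators\<close>

definition entry :: "('a \<Rightarrow> 'a) \<Rightarrow> 'a \<Rightarrow> 'a \<Rightarrow> complex" where
  "entry A f e = cip (A e) f"

text \<open>
  Matrix multiplication computes the composition: expand \<open>B e\<close> in the basis and apply the continuous
  maps \<open>A\<close> and \<open>cip _ f\<close> termwise.  This is where boundedness of the operators matters.
\<close>

lemma entry_comp:
  assumes E: "orthonormal_basis smul ip E" and "bounded_operator smul A" and "f \<in> E"
  shows "((\<lambda>F. mm F (entry A) (entry B) f e) \<longlongrightarrow> cip (A (B e)) f) (finite_subsets_at_top E)"
proof -
  have on: "orthonormal E" using E unfolding orthonormal_basis_iff ..
  interpret A: Vector_Spaces.linear smul smul A
    using assms by (simp add: bounded_operator_def)
  have "((\<lambda>g. A (smul (ip (B e) g) g)) has_sum A (B e)) E"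
    by (rule has_sum_bounded_linear[OF bounded_linear_bounded_operator orthonormal_expansion]) fact+
  from has_sum_bounded_linear[OF bounded_linear_cip[OF on \<open>f \<in> E\<close>] this]
  show ?thesis
    by (simp add: has_sum_def mm_def entry_def A.scale cip_scale_left flip: cip_def)
      (simp add: mult.commute)
qed

lemma hsq_entry_le:
  assumes E: "orthonormal_basis smul ip E" and S: "(\<lambda>e. (norm (A e))\<^sup>2) summable_on E"
    and F: "finite F" "F \<subseteq> E"
  shows "hsq F F (entry A) \<le> (\<Sum>\<^sub>\<infinity>e\<in>E. (norm (A e))\<^sup>2)"
proof -
  have on: "orthonormal F" using E F unfolding orthonormal_basis_iff by (blast intro: orthonormal_subset)
  have "hsq F F (entry A) = (\<Sum>e\<in>F. \<Sum>f\<in>F. (norm (ip (A e) f))\<^sup>2)"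
    unfolding hsq_def entry_def cmod_cip by (rule sum.swap)
  also have "\<dots> \<le> (\<Sum>e\<in>F. (norm (A e))\<^sup>2)"
    by (intro sum_mono Bessel on F)
  also have "\<dots> \<le> (\<Sum>\<^sub>\<infinity>e\<in>E. (norm (A e))\<^sup>2)"
    using S F by (intro finite_sum_le_infsum) auto
  finally show ?thesis .
qed

text \<open>
  Two limits are taken.  For a fixed finite block \<open>G\<close>, letting \<open>F\<close> grow turns the inequality
  for the \<open>F \<times> F\<close> blocks into a bound for the \<open>G \<times> G\<close> entries of the commutator.  Then, for finitely many
  columns, letting the set of rows grow turns sums of squared entries into squared norms by Parseval.
\<close>

lemma commutator_sum_bound:
  assumes E: "orthonormal_basis smul ip E"
    and A: "bounded_operator smul A" "(\<lambda>e. (norm (A e))\<^sup>2) summable_on E"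
    and B: "bounded_operator smul B" "(\<lambda>e. (norm (B e))\<^sup>2) summable_on E"
  defines "K \<equiv> 2 * (\<Sum>\<^sub>\<infinity>e\<in>E. (norm (A e))\<^sup>2) * (\<Sum>\<^sub>\<infinity>e\<in>E. (norm (B e))\<^sup>2)"
  shows "(\<lambda>e. (norm (commutator A B e))\<^sup>2) summable_on E"
    and "(\<Sum>\<^sub>\<infinity>e\<in>E. (norm (commutator A B e))\<^sup>2) \<le> K"
proof -
  let ?C = "commutator A B"
  let ?M = "\<lambda>F. mm F (entry A) (entry B) - mm F (entry B) (entry A)"
  have block: "hsq G G (entry ?C) \<le> K" if G: "finite G" "G \<subseteq> E" for G
  proof (rule tendsto_upperbound)
    show "((\<lambda>F. hsq G G (?M F)) \<longlongrightarrow> hsq G G (entry ?C)) (finite_subsets_at_top E)"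
    proof -
      have "((\<lambda>F. ?M F f e) \<longlongrightarrow> entry ?C f e) (finite_subsets_at_top E)" if "f \<in> G" for f e
        unfolding minus_apply commutator_def
        unfolding entry_def[of "\<lambda>x. A (B x) - B (A x)"] cip_diff_left
        using that G by (intro tendsto_diff entry_comp E A B) auto
      then show ?thesis unfolding hsq_def by (intro tendsto_intros)
    qed
    have "hsq G G (?M F) \<le> K" if F: "finite F" "G \<subseteq> F" "F \<subseteq> E" for F
    proof -
      have "hsq G G (?M F) \<le> hsq F F (?M F)"
        unfolding hsq_def using F
        by (intro order_trans[OF sum_mono sum_mono2] sum_mono2 sum_nonneg) auto
      also have "\<dots> \<le> 2 * hsq F F (entry A) * hsq F F (entry B)"
        by (rule bottcher_wenzel_matrix[OF F(1)])
      also have "\<dots> \<le> K"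
        unfolding K_def using F A B
        by (intro mult_mono hsq_entry_le E) (auto simp: hsq_nonneg infsum_nonneg)
      finally show ?thesis .
    qed
    then show "eventually (\<lambda>F. hsq G G (?M F) \<le> K) (finite_subsets_at_top E)"
      unfolding eventually_finite_subsets_at_top using G by blast
  qed simp
  have fin: "(\<Sum>e\<in>G. (norm (?C e))\<^sup>2) \<le> K" if G: "finite G" "G \<subseteq> E" for G
  proof (rule has_sum_le_finite_sums)
    show "((\<lambda>f. \<Sum>e\<in>G. (norm (ip (?C e) f))\<^sup>2) has_sum (\<Sum>e\<in>G. (norm (?C e))\<^sup>2)) E"
      using G(1) by induction (auto intro!: has_sum_add Parseval[OF E])
    fix F assume F: "finite F" "F \<subseteq> E"
    have "(\<Sum>f\<in>F. \<Sum>e\<in>G. (norm (ip (?C e) f))\<^sup>2) \<le> hsq (F \<union> G) (F \<union> G) (entry ?C)"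
      unfolding hsq_def entry_def cmod_cip using F G
      by (intro order_trans[OF sum_mono sum_mono2] sum_mono2 sum_nonneg) auto
    also have "\<dots> \<le> K" using F G by (intro block) auto
    finally show "(\<Sum>f\<in>F. \<Sum>e\<in>G. (norm (ip (?C e) f))\<^sup>2) \<le> K" .
  qed
  show summable: "(\<lambda>e. (norm (?C e))\<^sup>2) summable_on E"
    using fin by (intro nonneg_bdd_above_summable_on) (auto simp: bdd_above_def)
  show "(\<Sum>\<^sub>\<infinity>e\<in>E. (norm (?C e))\<^sup>2) \<le> K"
    by (rule infsum_le_finite_sums[OF summable fin])
qed

end

lemma summable_if_hs_norm_finite:
  assumes "E = (SOME E. orthonormal_basis smul ip E)" and "hs_norm smul ip A < \<infinity>"
  shows "(\<lambda>e. (norm (A e))\<^sup>2) summable_on E"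
  using assms by (auto simp: hs_norm_def Let_def split: if_splits)

lemma hs_norm_square:
  assumes "E = (SOME E. orthonormal_basis smul ip E)" and "(\<lambda>e. (norm (A e))\<^sup>2) summable_on E"
  shows "(hs_norm smul ip A)\<^sup>2 = ennreal (\<Sum>\<^sub>\<infinity>e\<in>E. (norm (A e))\<^sup>2)"
  using assms by (simp add: hs_norm_def Let_def ennreal_power infsum_nonneg)

theorem theorem2:
  fixes smul :: "'k::real_or_complex \<Rightarrow> 'a::banach \<Rightarrow> 'a"
    and ip :: "'a \<Rightarrow> 'a \<Rightarrow> 'k"
    and A B :: "'a \<Rightarrow> 'a"
  assumes "hilbert_space smul ip"
    and "separable_space (euclidean :: 'a topology)"
    and "bounded_operator smul A" and "bounded_operator smul B"
    and "hs_norm smul ip A < \<infinity>" and "hs_norm smul ip B < \<infinity>"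
  shows "(hs_norm smul ip (commutator A B))\<^sup>2
           \<le> 2 * (hs_norm smul ip A)\<^sup>2 * (hs_norm smul ip B)\<^sup>2"
proof -
  interpret hilbert_space smul ip by fact
  define E where "E = (SOME E. orthonormal_basis smul ip E)"
  have E: "orthonormal_basis smul ip E"
    unfolding E_def by (rule someI_ex[OF ex_orthonormal_basis])
  note A = summable_if_hs_norm_finite[OF E_def assms(5)]
  note B = summable_if_hs_norm_finite[OF E_def assms(6)]
  note C = commutator_sum_bound[OF E assms(3) A assms(4) B]
  have "ennreal (\<Sum>\<^sub>\<infinity>e\<in>E. (norm (commutator A B e))\<^sup>2)
    \<le> ennreal (2 * (\<Sum>\<^sub>\<infinity>e\<in>E. (norm (A e))\<^sup>2) * (\<Sum>\<^sub>\<infinity>e\<in>E. (norm (B e))\<^sup>2))"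
    by (rule ennreal_leI[OF C(2)])
  then show ?thesis
    unfolding hs_norm_square[OF E_def A] hs_norm_square[OF E_def B] hs_norm_square[OF E_def C(1)]
    by (simp add: ennreal_mult infsum_nonneg)
qed

end
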